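(* (Karlin–McGregor formula for non-symmetric QMCs.) Let $\Phi$ be a block tridiagonal quantum Markov chain on $\mathbb{Z}_{\ge 0}$ with internal space $\mathbb{C}^N$ and matrix representation $$\Phi=\begin{bmatrix} B_0 & C_1 & & \\ A_0 & B_1 & C_2 & \\ & A_1 & B_2 & C_3 \\ & & \ddots & \ddots & \ddots\end{bmatrix},\qquad A_n,B_n,C_{n+1}\in M_{N^2}(\mathbb{C}),\ n\ge 0,$$ with all $A_n$ nonsingular, and let $(Q_n)_{n\ge 0}$ be the associated matrix-valued polynomials. Suppose $W$ is an $N^2\times N^2$ matrix of measures (not necessarily symmetric or positive semidefinite) supported on a set $\Delta\subset\mathbb{C}$, with $\int_\Delta dW(x)$ nonsingular, with respect to which the polynomials $Q_n$ are semi-orthogonal, i.e. $$\int_\Delta x^k\,dW(x)\,Q_n(x)=0\qquad\text{for all integers } n>k\ge 0.$$ Then for every $i\in\mathbb{Z}_{\ge 0}$ and every $n\ge 0$ the $(0,i)$ block of $\Phi^n$ is $$\Phi^{(n)}_{0,i}=\Big(\int_\Delta dW(x)\Big)^{-1}\int_\Delta x^n\,dW(x)\,Q_i(x).$$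
   Context: A quantum Markov chain (QMC) on a vertex set $V$ with internal space $\mathbb{C}^N$ is a block matrix $\Phi=(\Phi_{ij})_{i,j\in V}$ of completely positive maps $\Phi_{ij}$ on $M_N(\mathbb{C})$ such that each column sum $\sum_{i\in V}\Phi_{ij}$ is trace-preserving; each $\Phi_{ij}$ is identified with the $N^2\times N^2$ matrix $M$ satisfying $\mathrm{vec}(\Phi_{ij}(X))=M\,\mathrm{vec}(X)$, where $\mathrm{vec}$ stacks the rows of a matrix. $A_n,B_n,C_n$ are the blocks in positions $(n+1,n)$, $(n,n)$, $(n-1,n)$, and $\Phi^{(n)}_{0,i}$ denotes the $(0,i)$ block of $\Phi^n$. The associated matrix-valued polynomials are given by $Q_0(x)=I_{N^2}$, $Q_{-1}(x)=0$ and $xQ_n(x)=Q_{n+1}(x)A_n+Q_n(x)B_n+Q_{n-1}(x)C_n$, $n\ge 0$. The matrix of measures $W$ has complex-valued measures as entries, and all moments $\int_\Delta x^k\,dW(x)$ are assumed finite. *)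

theory Defs
  imports "HOL-Analysis.Analysis"
begin

section \<open>Completely positive maps and quantum Markov chains\<close>

text \<open>
  \<^typ>\<open>complex^'n^'n\<close> plays the role of $M_N(\mathbb{C})$ with $N$ the cardinality of \<^typ>\<open>'n\<close>.
  A $k \times k$ block matrix with blocks in $M_N(\mathbb{C})$ is a function \<open>X a b\<close>
  restricted to indices \<open>a, b < k\<close>.
\<close>

definition block_psd :: "nat \<Rightarrow> (nat \<Rightarrow> nat \<Rightarrow> complex^'n^'n) \<Rightarrow> bool" where
  "block_psd k X \<longleftrightarrow>
     (\<forall>v :: nat \<Rightarrow> complex^'n.
        (\<Sum>a<k. \<Sum>b<k. \<Sum>i\<in>UNIV. \<Sum>j\<in>UNIV. cnj (v a $ i) * X a b $ i $ j * v b $ j)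
          \<in> \<real>\<^sub>\<ge>\<^sub>0)"

definition complex_linear_map :: "(complex^'n^'n \<Rightarrow> complex^'n^'n) \<Rightarrow> bool" where
  "complex_linear_map \<Phi> \<longleftrightarrow>
     (\<forall>X Y. \<Phi> (X + Y) = \<Phi> X + \<Phi> Y) \<and>
     (\<forall>c X. \<Phi> (map_matrix ((*) c) X) = map_matrix ((*) c) (\<Phi> X))"

text \<open>Blockwise application of \<open>\<Phi>\<close> is the ampliation of \<open>\<Phi>\<close> by the identity of $M_k(\mathbb{C})$.\<close>

definition completely_positive :: "(complex^'n^'n \<Rightarrow> complex^'n^'n) \<Rightarrow> bool" where
  "completely_positive \<Phi> \<longleftrightarrow>
     complex_linear_map \<Phi> \<and>
     (\<forall>k X. block_psd k X \<longrightarrow> block_psd k (\<lambda>a b. \<Phi> (X a b)))"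

text \<open>The vertex set is the whole type \<^typ>\<open>'v\<close>; \<open>\<Phi> i j\<close> is the block in row \<open>i\<close>, column \<open>j\<close>.\<close>

definition quantum_markov_chain ::
    "('v \<Rightarrow> 'v \<Rightarrow> complex^'n^'n \<Rightarrow> complex^'n^'n) \<Rightarrow> bool" where
  "quantum_markov_chain \<Phi> \<longleftrightarrow>
     (\<forall>i j. completely_positive (\<Phi> i j)) \<and>
     (\<forall>j X. (\<lambda>i. \<Phi> i j X) summable_on UNIV \<and>
            trace (\<Sum>\<^sub>\<infinity>i. \<Phi> i j X) = trace X)"


section \<open>Matrix representation\<close>

text \<open>
  The coordinates of $\mathbb{C}^{N^2}$ are indexed by pairs (row, column); row stacking
  is the lexicographic enumeration of these pairs.
\<close>

definition vec_rows :: "complex^'n^'n \<Rightarrow> complex^('n \<times> 'n)" where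
  "vec_rows X = (\<chi> p. X $ fst p $ snd p)"

definition matrix_rep ::
    "(complex^'n^'n \<Rightarrow> complex^'n^'n) \<Rightarrow> complex^('n \<times> 'n)^('n \<times> 'n)" where
  "matrix_rep \<Phi> = (THE M. \<forall>X. vec_rows (\<Phi> X) = M *v vec_rows X)"

lemma matrix_rep_unique:
  fixes \<Phi> :: "complex^'n^'n \<Rightarrow> complex^'n^'n"
  assumes "complex_linear_map \<Phi>"
  shows "\<exists>!M. \<forall>X. vec_rows (\<Phi> X) = M *v vec_rows X"
proof -
  define E :: "'n \<times> 'n \<Rightarrow> complex^'n^'n"
    where "E = (\<lambda>p. \<chi> i j. if (i, j) = p then 1 else 0)"
  define M :: "complex^('n \<times> 'n)^('n \<times> 'n)"
    where "M = (\<chi> q p. vec_rows (\<Phi> (E p)) $ q)"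
  have vE: "vec_rows (E p) = axis p 1" for p
    by (auto simp: vec_rows_def E_def axis_def vec_eq_iff)
  have zero: "\<Phi> 0 = 0"
  proof -
    have "\<Phi> 0 + \<Phi> 0 = \<Phi> 0 + 0"
      using assms unfolding complex_linear_map_def by (metis add.right_neutral)
    then show ?thesis by simp
  qed
  have sum: "\<Phi> (sum f S) = (\<Sum>p\<in>S. \<Phi> (f p))"
    if "finite S" for S :: "('n \<times> 'n) set" and f
    using that assms by (induction S) (auto simp: zero complex_linear_map_def)
  have "vec_rows (\<Phi> X) = M *v vec_rows X" for X
  proof -
    have X: "X = (\<Sum>p\<in>UNIV. map_matrix ((*) (X $ fst p $ snd p)) (E p))"
    proof -
      have "(\<Sum>p\<in>UNIV. map_matrix ((*) (X $ fst p $ snd p)) (E p)) $ i $ j = X $ i $ j" for i j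
      proof -
        have "(\<Sum>p\<in>UNIV. map_matrix ((*) (X $ fst p $ snd p)) (E p)) $ i $ j
            = (\<Sum>p\<in>UNIV. X $ fst p $ snd p * (if (i, j) = p then 1 else 0))"
          by (simp add: map_matrix_def E_def)
        also have "\<dots> = (\<Sum>p\<in>UNIV. if p = (i, j) then X $ fst p $ snd p else 0)"
          by (rule sum.cong) auto
        also have "\<dots> = X $ i $ j"
          by (subst sum.delta) auto
        finally show ?thesis .
      qed
      then show ?thesis by (simp add: vec_eq_iff)
    qed
    have "\<Phi> X = (\<Sum>p\<in>UNIV. map_matrix ((*) (X $ fst p $ snd p)) (\<Phi> (E p)))"
      by (subst X) (use assms in \<open>simp add: sum complex_linear_map_def\<close>)
    then show ?thesis
      by (simp add: vec_eq_iff vec_rows_def M_def matrix_vector_mult_def map_matrix_def mult.commute)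
  qed
  moreover have "M' = M" if "\<forall>X. vec_rows (\<Phi> X) = M' *v vec_rows X" for M'
  proof -
    have col: "L *v axis p 1 = column p L" for L :: "complex^('n \<times> 'n)^('n \<times> 'n)" and p
      by (simp add: matrix_vector_mult_def column_def axis_def if_distrib cong: if_cong)
    have "column p M' = column p M" for p
      using that calculation[of "E p"] by (simp add: vE col)
    then show ?thesis by (simp add: column_def vec_eq_iff)
  qed
  ultimately show ?thesis by blast
qed


section \<open>Block matrices\<close>

text \<open>For block tridiagonal matrices the sum over \<open>l\<close> has only finitely many nonzero terms.\<close>

definition block_mult ::
    "(nat \<Rightarrow> nat \<Rightarrow> complex^'m^'m) \<Rightarrow> (nat \<Rightarrow> nat \<Rightarrow> complex^'m^'m) \<Rightarrow> nat \<Rightarrow> nat \<Rightarrow> complex^'m^'m"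
  where "block_mult S T i j = (\<Sum>\<^sub>\<infinity>l. S i l ** T l j)"

primrec block_power ::
    "(nat \<Rightarrow> nat \<Rightarrow> complex^'m^'m) \<Rightarrow> nat \<Rightarrow> nat \<Rightarrow> nat \<Rightarrow> complex^'m^'m" where
  "block_power T 0 = (\<lambda>i j. if i = j then mat 1 else 0)"
| "block_power T (Suc n) = block_mult (block_power T n) T"

text \<open>\<open>C 0\<close> does not occur.\<close>

definition block_tridiagonal ::
    "(nat \<Rightarrow> complex^'m^'m) \<Rightarrow> (nat \<Rightarrow> complex^'m^'m) \<Rightarrow> (nat \<Rightarrow> complex^'m^'m) \<Rightarrow>
     nat \<Rightarrow> nat \<Rightarrow> complex^'m^'m" where
  "block_tridiagonal A B C i j =
     (if i = Suc j then A j
      else if i = j then B j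
      else if Suc i = j then C j
      else 0)"

text \<open>The convention $Q_{-1} = 0$ is built into the case \<open>n = 0\<close>.\<close>

definition associated_polynomials ::
    "(nat \<Rightarrow> complex^'m^'m) \<Rightarrow> (nat \<Rightarrow> complex^'m^'m) \<Rightarrow> (nat \<Rightarrow> complex^'m^'m) \<Rightarrow>
     (nat \<Rightarrow> complex \<Rightarrow> complex^'m^'m) \<Rightarrow> bool" where
  "associated_polynomials A B C Q \<longleftrightarrow>
     (\<forall>x. Q 0 x = mat 1) \<and>
     (\<forall>n x. map_matrix ((*) x) (Q n x) =
        Q (Suc n) x ** A n + Q n x ** B n + (if n = 0 then 0 else Q (n - 1) x ** C n))"


section \<open>Complex measures\<close>

text \<open>
  Of the library measure \<open>M\<close> only the underlying measurable space is used. Taking all sets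
  equal to the empty set shows that \<open>\<mu> {} = 0\<close>.
\<close>

definition complex_measure :: "'a measure \<Rightarrow> ('a set \<Rightarrow> complex) \<Rightarrow> bool" where
  "complex_measure M \<mu> \<longleftrightarrow>
     (\<forall>E :: nat \<Rightarrow> 'a set. range E \<subseteq> sets M \<longrightarrow> disjoint_family E \<longrightarrow>
        (\<lambda>n. \<mu> (E n)) sums \<mu> (\<Union>n. E n))"

text \<open>
  The positive part of the Jordan decomposition of a signed measure \<open>\<nu>\<close>. Since \<^const>\<open>ennreal\<close>
  maps negative reals to 0, the sets with negative measure do not affect the supremum.
\<close>

definition positive_variation :: "'a measure \<Rightarrow> ('a set \<Rightarrow> real) \<Rightarrow> 'a measure" where
  "positive_variation M \<nu> =
     measure_of (space M) (sets M) (\<lambda>E. SUP F\<in>{F\<in>sets M. F \<subseteq> E}. ennreal (\<nu> F))"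

definition negative_variation :: "'a measure \<Rightarrow> ('a set \<Rightarrow> real) \<Rightarrow> 'a measure" where
  "negative_variation M \<nu> = positive_variation M (\<lambda>E. - \<nu> E)"

definition complex_measure_integrable ::
    "'a measure \<Rightarrow> ('a set \<Rightarrow> complex) \<Rightarrow> ('a \<Rightarrow> complex) \<Rightarrow> bool" where
  "complex_measure_integrable M \<mu> f \<longleftrightarrow>
     integrable (positive_variation M (\<lambda>E. Re (\<mu> E))) f \<and>
     integrable (negative_variation M (\<lambda>E. Re (\<mu> E))) f \<and>
     integrable (positive_variation M (\<lambda>E. Im (\<mu> E))) f \<and>
     integrable (negative_variation M (\<lambda>E. Im (\<mu> E))) f"

definition complex_measure_integral ::
    "'a measure \<Rightarrow> ('a set \<Rightarrow> complex) \<Rightarrow> ('a \<Rightarrow> complex) \<Rightarrow> complex" where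
  "complex_measure_integral M \<mu> f =
     ((\<integral>x. f x \<partial>positive_variation M (\<lambda>E. Re (\<mu> E)))
       - (\<integral>x. f x \<partial>negative_variation M (\<lambda>E. Re (\<mu> E))))
     + \<i> * ((\<integral>x. f x \<partial>positive_variation M (\<lambda>E. Im (\<mu> E)))
       - (\<integral>x. f x \<partial>negative_variation M (\<lambda>E. Im (\<mu> E))))"

lemma sets_positive_variation [simp]: "sets (positive_variation M \<nu>) = sets M"
  by (simp add: positive_variation_def)

lemma space_positive_variation [simp]: "space (positive_variation M \<nu>) = space M"
  by (simp add: positive_variation_def)

lemma emeasure_positive_variation:
  fixes \<nu> :: "'a set \<Rightarrow> real"
  assumes sums: "\<And>E :: nat \<Rightarrow> 'a set. range E \<subseteq> sets M \<Longrightarrow> disjoint_family E \<Longrightarrow>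
      (\<lambda>n. \<nu> (E n)) sums \<nu> (\<Union>n. E n)"
    and G: "G \<in> sets M"
  shows "emeasure (positive_variation M \<nu>) G = (SUP F\<in>{F\<in>sets M. F \<subseteq> G}. ennreal (\<nu> F))"
proof -
  define S where "S G = (SUP F\<in>{F\<in>sets M. F \<subseteq> G}. ennreal (\<nu> F))" for G
  have empty: "\<nu> {} = 0"
  proof -
    have "(\<lambda>n::nat. \<nu> {}) sums \<nu> {}"
      using sums[of "\<lambda>_. {}"] by (simp add: disjoint_family_on_def)
    then have "summable (\<lambda>n::nat. \<nu> {})" by (rule sums_summable)
    then show ?thesis by (simp add: summable_const_iff)
  qed
  have add: "\<nu> (F \<union> F') = \<nu> F + \<nu> F'" if "F \<in> sets M" "F' \<in> sets M" "F \<inter> F' = {}" for F F'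
  proof -
    have "(\<lambda>n. \<nu> (binaryset F F' n)) sums \<nu> (\<Union>n. binaryset F F' n)"
      using that by (intro sums)
        (auto simp: disjoint_family_on_def binaryset_def)
    moreover have "(\<lambda>n. \<nu> (binaryset F F' n)) sums (\<nu> F + \<nu> F')"
      using binaryset_sums[of \<nu> F F'] empty by simp
    ultimately show ?thesis
      by (metis UN_binaryset_eq sums_unique2)
  qed
  have upper: "ennreal (\<nu> F) \<le> S G" if "F \<in> sets M" "F \<subseteq> G" for F G
    unfolding S_def using that by (intro SUP_upper) auto
  have super: "S G + S G' \<le> S (G \<union> G')" if "G \<inter> G' = {}" for G G'
  proof -
    have ne: "{F \<in> sets M. F \<subseteq> H} \<noteq> {}" for H by auto
    have 1: "ennreal (\<nu> F) + ennreal (\<nu> F') \<le> S (G \<union> G')"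
      if "F \<in> sets M" "F \<subseteq> G" "F' \<in> sets M" "F' \<subseteq> G'" for F F'
    proof -
      define P where "P = (\<lambda>F. if \<nu> F < 0 then {} else F)"
      have P: "P F \<in> sets M" "P F \<subseteq> F" "\<nu> (P F) \<ge> 0" "ennreal (\<nu> (P F)) = ennreal (\<nu> F)"
        if "F \<in> sets M" for F
        using that empty by (auto simp: P_def ennreal_neg)
      have "ennreal (\<nu> F) + ennreal (\<nu> F') = ennreal (\<nu> (P F) + \<nu> (P F'))"
        using P[OF \<open>F \<in> sets M\<close>] P[OF \<open>F' \<in> sets M\<close>] by (simp add: ennreal_plus)
      also have "\<dots> = ennreal (\<nu> (P F \<union> P F'))"
        using P(1,2)[OF \<open>F \<in> sets M\<close>] P(1,2)[OF \<open>F' \<in> sets M\<close>] that \<open>G \<inter> G' = {}\<close>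
        by (subst add) blast+
      also have "\<dots> \<le> S (G \<union> G')"
        using P(1,2)[OF \<open>F \<in> sets M\<close>] P(1,2)[OF \<open>F' \<in> sets M\<close>] that
        by (intro upper) auto
      finally show ?thesis .
    qed
    have 2: "ennreal (\<nu> F) + S G' \<le> S (G \<union> G')" if "F \<in> sets M" "F \<subseteq> G" for F
    proof -
      have "ennreal (\<nu> F) + S G' = (SUP F'\<in>{F'\<in>sets M. F' \<subseteq> G'}. ennreal (\<nu> F) + ennreal (\<nu> F'))"
        unfolding S_def using ne by (subst ennreal_SUP_add_right) auto
      also have "\<dots> \<le> S (G \<union> G')" using that 1 by (intro SUP_least) auto
      finally show ?thesis .
    qed
    have "S G + S G' = (SUP F\<in>{F\<in>sets M. F \<subseteq> G}. ennreal (\<nu> F) + S G')"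
      unfolding S_def[of G] using ne by (subst ennreal_SUP_add_left) auto
    also have "\<dots> \<le> S (G \<union> G')" using 2 by (intro SUP_least) auto
    finally show ?thesis .
  qed
  have mono: "S G \<le> S G'" if "G \<subseteq> G'" for G G'
    unfolding S_def using that by (intro SUP_subset_mono) auto
  have "countably_additive (sets M) S"
  proof (rule countably_additiveI)
    fix E :: "nat \<Rightarrow> 'a set"
    assume E: "range E \<subseteq> sets M" and disj: "disjoint_family E"
    show "(\<Sum>n. S (E n)) = S (\<Union>n. E n)"
    proof (rule antisym)
      have fin: "(\<Sum>n<m. S (E n)) \<le> S (\<Union>n<m. E n)" for m
      proof (induction m)
        case 0
        show ?case by simp
      next
        case (Suc m)
        have "(\<Sum>n<Suc m. S (E n)) \<le> S (\<Union>n<m. E n) + S (E m)"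
          using Suc by (simp add: add_right_mono)
        also have "\<dots> \<le> S ((\<Union>n<m. E n) \<union> E m)"
        proof (rule super)
          have "E n \<inter> E m = {}" if "n < m" for n
            using disj that unfolding disjoint_family_on_def by simp
          then show "(\<Union>n<m. E n) \<inter> E m = {}" by blast
        qed
        also have "(\<Union>n<m. E n) \<union> E m = (\<Union>n<Suc m. E n)"
          by (auto simp: less_Suc_eq)
        finally show ?case .
      qed
      show "(\<Sum>n. S (E n)) \<le> S (\<Union>n. E n)"
        unfolding suminf_eq_SUP
        by (intro SUP_least order_trans[OF fin] mono) auto
    next
      show "S (\<Union>n. E n) \<le> (\<Sum>n. S (E n))"
        unfolding S_def[of "\<Union>n. E n"]
      proof (rule SUP_least, clarify)
        fix F assume F: "F \<in> sets M" "F \<subseteq> (\<Union>n. E n)"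
        have "(\<lambda>n. \<nu> (F \<inter> E n)) sums \<nu> (\<Union>n. F \<inter> E n)"
        proof (rule sums)
          show "range (\<lambda>n. F \<inter> E n) \<subseteq> sets M" using E F by auto
          show "disjoint_family (\<lambda>n. F \<inter> E n)"
            by (rule disjoint_family_subset[OF disj]) auto
        qed
        also have "(\<Union>n. F \<inter> E n) = F" using F by auto
        finally have "(\<lambda>m. ennreal (\<Sum>n<m. \<nu> (F \<inter> E n))) \<longlonglongrightarrow> ennreal (\<nu> F)"
          unfolding sums_def by (rule tendsto_ennrealI)
        moreover have "ennreal (\<Sum>n<m. \<nu> (F \<inter> E n)) \<le> (\<Sum>n. S (E n))" for m
        proof -
          have "ennreal (\<Sum>n<m. \<nu> (F \<inter> E n)) \<le> ennreal (\<Sum>n<m. max 0 (\<nu> (F \<inter> E n)))"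
            by (intro ennreal_leI sum_mono) auto
          also have "\<dots> = (\<Sum>n<m. ennreal (max 0 (\<nu> (F \<inter> E n))))"
            by (rule sum_ennreal[symmetric]) auto
          also have "\<dots> \<le> (\<Sum>n<m. S (E n))"
            using E F by (intro sum_mono) (auto simp: max_def intro!: upper)
          also have "\<dots> \<le> (\<Sum>n. S (E n))"
            by (intro sum_le_suminf) auto
          finally show ?thesis .
        qed
        ultimately show "ennreal (\<nu> F) \<le> (\<Sum>n. S (E n))"
          by (intro LIMSEQ_le_const2) auto
      qed
    qed
  qed
  moreover have "positive (sets M) S"
  proof -
    have "{F \<in> sets M. F \<subseteq> {}} = {{}}" by auto
    then show ?thesis by (simp add: positive_def S_def empty)
  qed
  moreover have "positive_variation M \<nu> = measure_of (space M) (sets M) S"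
    by (simp add: positive_variation_def S_def[abs_def])
  ultimately have "emeasure (positive_variation M \<nu>) G = S G"
    using G by (simp add: emeasure_measure_of_sigma sets.sigma_algebra_axioms)
  then show ?thesis by (simp add: S_def)
qed


section \<open>Matrices of measures\<close>

text \<open>
  Matrices of complex Borel measures on \<open>\<Delta>\<close>, with respect to whose entries all powers of \<open>x\<close>
  are integrable. The measures live on the Borel subsets of the subspace \<open>\<Delta>\<close>, so that
  \<open>\<Delta>\<close> may be an arbitrary subset of the plane and all integrals are over \<open>\<Delta>\<close>.
\<close>

definition matrix_of_measures :: "complex set \<Rightarrow> (complex set \<Rightarrow> complex)^'m^'m \<Rightarrow> bool" where
  "matrix_of_measures \<Delta> W \<longleftrightarrow> (\<forall>i j. complex_measure (restrict_space borel \<Delta>) (W $ i $ j))"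

definition finite_moments :: "complex set \<Rightarrow> (complex set \<Rightarrow> complex)^'m^'m \<Rightarrow> bool" where
  "finite_moments \<Delta> W \<longleftrightarrow>
     (\<forall>k i j. complex_measure_integrable (restrict_space borel \<Delta>) (W $ i $ j) (\<lambda>x. x ^ k))"

text \<open>$\int_\Delta dW(x)\, F(x)$, with $dW$ multiplying from the left.\<close>

definition matrix_integral ::
    "complex set \<Rightarrow> (complex set \<Rightarrow> complex)^'m^'m \<Rightarrow> (complex \<Rightarrow> complex^'m^'m) \<Rightarrow> complex^'m^'m"
  where
  "matrix_integral \<Delta> W F =
     (\<chi> i j. \<Sum>l\<in>UNIV.
        complex_measure_integral (restrict_space borel \<Delta>) (W $ i $ l) (\<lambda>x. F x $ l $ j))"

definition semi_orthogonal ::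
    "complex set \<Rightarrow> (complex set \<Rightarrow> complex)^'m^'m \<Rightarrow> (nat \<Rightarrow> complex \<Rightarrow> complex^'m^'m) \<Rightarrow> bool"
  where
  "semi_orthogonal \<Delta> W Q \<longleftrightarrow>
     (\<forall>k n. k < n \<longrightarrow> matrix_integral \<Delta> W (\<lambda>x. map_matrix ((*) (x ^ k)) (Q n x)) = 0)"

end

(*
  Multiplying the recurrence for Q_i by x^n and integrating shows that the moments
  J n i = \<integral> x^n dW(x) Q_i(x) satisfy
    J (n+1) i = J n (i+1) A_i + J n i B_i + J n (i-1) C_i,
  which is the recurrence satisfied by the row (\<Phi>^n)_{0,i}. Semi-orthogonality with k = 0 says that
  J 0 i = 0 for i > 0, so both sides also agree for n = 0 after normalization by J 0 0.
*)

theory Submission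
  imports Defs
begin

lemma map_matrix_mult_nth [simp]: "map_matrix ((*) c) X $ i $ j = c * X $ i $ j"
  by (simp add: map_matrix_def)

lemma map_matrix_mult_add:
  "map_matrix ((*) c) (X + Y) = map_matrix ((*) c) X + map_matrix ((*) c) (Y :: complex^'n^'m)"
  by (simp add: vec_eq_iff distrib_left)

lemma map_matrix_mult_zero [simp]: "map_matrix ((*) c) (0 :: complex^'n^'m) = 0"
  by (simp add: vec_eq_iff)

lemma map_matrix_mult_matrix_mult:
  "map_matrix ((*) c) (X ** Y) = map_matrix ((*) c) X ** (Y :: complex^'n^'m)"
  by (simp add: vec_eq_iff matrix_matrix_mult_def sum_distrib_left mult.assoc)

lemma map_matrix_mult_mult:
  "map_matrix ((*) c) (map_matrix ((*) d) X) = map_matrix ((*) (c * d)) (X :: complex^'n^'m)"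
  by (simp add: vec_eq_iff mult.assoc)

lemma complex_measure_integrable_add:
  assumes "complex_measure_integrable M \<mu> f" "complex_measure_integrable M \<mu> g"
  shows "complex_measure_integrable M \<mu> (\<lambda>x. f x + g x)"
  using assms by (simp add: complex_measure_integrable_def)

lemma complex_measure_integrable_mult_left:
  assumes "complex_measure_integrable M \<mu> f"
  shows "complex_measure_integrable M \<mu> (\<lambda>x. f x * c)"
  using assms by (simp add: complex_measure_integrable_def)

lemma complex_measure_integrable_zero: "complex_measure_integrable M \<mu> (\<lambda>x. 0)"
  by (simp add: complex_measure_integrable_def)

lemma complex_measure_integrable_sum:
  assumes "\<And>p. p \<in> S \<Longrightarrow> complex_measure_integrable M \<mu> (f p)"
  shows "complex_measure_integrable M \<mu> (\<lambda>x. \<Sum>p\<in>S. f p x)"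
  using assms by (simp add: complex_measure_integrable_def)

lemma complex_measure_integral_zero: "complex_measure_integral M \<mu> (\<lambda>x. 0) = 0"
  by (simp add: complex_measure_integral_def)

lemma complex_measure_integral_add:
  assumes "complex_measure_integrable M \<mu> f" "complex_measure_integrable M \<mu> g"
  shows "complex_measure_integral M \<mu> (\<lambda>x. f x + g x) =
    complex_measure_integral M \<mu> f + complex_measure_integral M \<mu> g"
  using assms
  by (simp add: complex_measure_integrable_def complex_measure_integral_def algebra_simps)

lemma complex_measure_integral_mult_left:
  assumes "complex_measure_integrable M \<mu> f"
  shows "complex_measure_integral M \<mu> (\<lambda>x. f x * c) = complex_measure_integral M \<mu> f * c"
  using assms
  by (simp add: complex_measure_integrable_def complex_measure_integral_def algebra_simps)

lemma complex_measure_integral_sum: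
  assumes "\<And>p. p \<in> S \<Longrightarrow> complex_measure_integrable M \<mu> (f p)"
  shows "complex_measure_integral M \<mu> (\<lambda>x. \<Sum>p\<in>S. f p x) =
    (\<Sum>p\<in>S. complex_measure_integral M \<mu> (f p))"
  using assms
  \<comment> \<open>For infinite \<open>S\<close> both sums are 0 by convention, so only the
    integral of the zero function remains.\<close>
  by (induction S rule: infinite_finite_induct)
    (simp_all add: complex_measure_integral_zero complex_measure_integral_add
      complex_measure_integrable_sum)

text \<open>Every entry of \<open>W\<close> is paired with every entry of \<open>F\<close>, whereas
  \<open>matrix_integral\<close> pairs \<open>W $ i $ l\<close> with row \<open>l\<close> of
  \<open>F\<close> only. \<open>finite_moments\<close> bounds the powers of x against all entries of
  \<open>W\<close>, so this uniform form is available.\<close>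

definition matrix_integrable ::
    "complex set \<Rightarrow> (complex set \<Rightarrow> complex)^'m^'m \<Rightarrow> (complex \<Rightarrow> complex^'m^'m) \<Rightarrow> bool" where
  "matrix_integrable \<Delta> W F \<longleftrightarrow>
     (\<forall>i l p j. complex_measure_integrable (restrict_space borel \<Delta>) (W $ i $ l) (\<lambda>x. F x $ p $ j))"

lemma matrix_integrable_add:
  assumes "matrix_integrable \<Delta> W F" "matrix_integrable \<Delta> W G"
  shows "matrix_integrable \<Delta> W (\<lambda>x. F x + G x)"
  using assms by (simp add: matrix_integrable_def complex_measure_integrable_add)

lemma matrix_integrable_zero: "matrix_integrable \<Delta> W (\<lambda>x. 0)"
  by (simp add: matrix_integrable_def complex_measure_integrable_zero)

lemma matrix_integrable_mult_left:
  assumes "matrix_integrable \<Delta> W F"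
  shows "matrix_integrable \<Delta> W (\<lambda>x. F x ** K)"
  using assms
  by (simp add: matrix_integrable_def matrix_matrix_mult_def complex_measure_integrable_sum
      complex_measure_integrable_mult_left)

lemma matrix_integrable_minus:
  assumes "matrix_integrable \<Delta> W F" "matrix_integrable \<Delta> W G"
  shows "matrix_integrable \<Delta> W (\<lambda>x. F x - G x)"
  using assms by (simp add: matrix_integrable_def complex_measure_integrable_def)

lemma matrix_integral_zero: "matrix_integral \<Delta> W (\<lambda>x. 0) = 0"
  by (simp add: matrix_integral_def vec_eq_iff complex_measure_integral_zero)

lemma matrix_integral_add:
  assumes "matrix_integrable \<Delta> W F" "matrix_integrable \<Delta> W G"
  shows "matrix_integral \<Delta> W (\<lambda>x. F x + G x) = matrix_integral \<Delta> W F + matrix_integral \<Delta> W G"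
  using assms
  by (simp add: matrix_integral_def matrix_integrable_def vec_eq_iff
      complex_measure_integral_add sum.distrib)

text \<open>Since dW multiplies from the left, a constant factor leaves the integral on the right,
  the side on which the coefficients of the recurrence stand. Entrywise the two sides are one finite
  double sum taken in both orders.\<close>

lemma matrix_integral_mult_left:
  assumes "matrix_integrable \<Delta> W F"
  shows "matrix_integral \<Delta> W (\<lambda>x. F x ** K) = matrix_integral \<Delta> W F ** K"
proof -
  have "matrix_integral \<Delta> W (\<lambda>x. F x ** K) $ i $ j = (matrix_integral \<Delta> W F ** K) $ i $ j" for i j
  proof -
    let ?I = "\<lambda>l p. complex_measure_integral (restrict_space borel \<Delta>) (W $ i $ l) (\<lambda>x. F x $ l $ p)"
    have "matrix_integral \<Delta> W (\<lambda>x. F x ** K) $ i $ j = (\<Sum>l\<in>UNIV. \<Sum>p\<in>UNIV. ?I l p * K $ p $ j)"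
      using assms
      by (simp add: matrix_integral_def matrix_integrable_def matrix_matrix_mult_def
          complex_measure_integral_sum complex_measure_integral_mult_left
          complex_measure_integrable_mult_left)
    also have "\<dots> = (\<Sum>p\<in>UNIV. \<Sum>l\<in>UNIV. ?I l p * K $ p $ j)"
      by (rule sum.swap)
    also have "\<dots> = (matrix_integral \<Delta> W F ** K) $ i $ j"
      by (simp add: matrix_integral_def matrix_matrix_mult_def sum_distrib_right)
    finally show ?thesis .
  qed
  then show ?thesis by (simp add: vec_eq_iff)
qed

lemma invertible_matrix_inv:
  assumes "invertible M"
  shows "M ** matrix_inv M = mat 1" "matrix_inv M ** M = mat 1"
proof -
  have "M ** matrix_inv M = mat 1 \<and> matrix_inv M ** M = mat 1"
    unfolding matrix_inv_def by (rule someI_ex) (use assms in \<open>simp add: invertible_def\<close>)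
  then show "M ** matrix_inv M = mat 1" "matrix_inv M ** M = mat 1" by simp_all
qed

text \<open>Scalars commute with right multiplication, so the recurrence may be multiplied by x^k.
  One power of x is thereby traded for a step to the neighbouring indices.\<close>

lemma associated_polynomials_shift:
  assumes "associated_polynomials A B C Q"
  shows "map_matrix ((*) (x ^ Suc k)) (Q n x) =
    map_matrix ((*) (x ^ k)) (Q (Suc n) x) ** A n + map_matrix ((*) (x ^ k)) (Q n x) ** B n
    + (if n = 0 then 0 else map_matrix ((*) (x ^ k)) (Q (n - 1) x) ** C n)"
proof -
  have "map_matrix ((*) (x ^ Suc k)) (Q n x) = map_matrix ((*) (x ^ k)) (map_matrix ((*) x) (Q n x))"
    by (simp add: map_matrix_mult_mult mult.commute)
  also have "map_matrix ((*) x) (Q n x) =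
      Q (Suc n) x ** A n + Q n x ** B n + (if n = 0 then 0 else Q (n - 1) x ** C n)"
    using assms by (simp add: associated_polynomials_def)
  finally show ?thesis
    by (simp add: map_matrix_mult_add map_matrix_mult_matrix_mult split: if_splits)
qed

text \<open>\<open>Q\<close> is given only by its recurrence, not as explicit polynomials.
  Nonsingularity of \<open>A m\<close> allows solving for \<open>Q (Suc m)\<close>, which reduces
  integrability to lower indices and finally to the scalar moments of \<open>W\<close>.\<close>

lemma matrix_integrable_associated_polynomials:
  assumes Q: "associated_polynomials A B C Q"
    and A: "\<And>n. invertible (A n)"
    and W: "finite_moments \<Delta> W"
  shows "matrix_integrable \<Delta> W (\<lambda>x. map_matrix ((*) (x ^ k)) (Q n x))"
\<comment> \<open>Lowering the index raises the exponent, so \<open>k\<close> must vary; the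
  recurrence reaches back two indices, hence strong induction.\<close>
proof (induction n arbitrary: k rule: less_induct)
  case (less n)
  show ?case
  proof (cases n)
    case 0
    have "Q 0 x = mat 1" for x
      using Q by (simp add: associated_polynomials_def)
    \<comment> \<open>Each entry of x^k times the identity is x^k times a constant 0 or 1.\<close>
    with W 0 show ?thesis
      by (simp add: matrix_integrable_def finite_moments_def mat_def
          complex_measure_integrable_mult_left)
  next
    case (Suc m)
    let ?X = "\<lambda>k n x. map_matrix ((*) (x ^ k)) (Q n x)"
    let ?R = "\<lambda>x. if m = 0 then 0 else ?X k (m - 1) x ** C m"
    have R: "matrix_integrable \<Delta> W ?R"
      using less Suc by (cases m) (simp_all add: matrix_integrable_zero matrix_integrable_mult_left)
    have "?X k n x = (?X (Suc k) m x - ?X k m x ** B m - ?R x) ** matrix_inv (A m)" for x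
    proof -
      have "?X (Suc k) m x - ?X k m x ** B m - ?R x = ?X k n x ** A m"
        unfolding associated_polynomials_shift[OF Q] Suc by simp
      then show ?thesis
        using A by (metis invertible_matrix_inv(1) matrix_mul_assoc matrix_mul_rid)
    qed
    moreover have "matrix_integrable \<Delta> W
        (\<lambda>x. (?X (Suc k) m x - ?X k m x ** B m - ?R x) ** matrix_inv (A m))"
      by (intro matrix_integrable_mult_left matrix_integrable_minus R less) (simp_all add: Suc)
    ultimately show ?thesis by simp
  qed
qed

text \<open>Column \<open>j\<close> of a block tridiagonal matrix vanishes outside the rows
  \<open>j - 1\<close>, \<open>j\<close> and \<open>Suc j\<close>, so the infinite sum is finite for
  every \<open>S\<close>.\<close>

lemma block_mult_block_tridiagonal:
  "block_mult S (block_tridiagonal A B C) i j =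
    S i (Suc j) ** A j + S i j ** B j + (if j = 0 then 0 else S i (j - 1) ** C j)"
proof -
  have "block_mult S (block_tridiagonal A B C) i j =
      (\<Sum>\<^sub>\<infinity>l\<in>{j - 1, j, Suc j}. S i l ** block_tridiagonal A B C l j)"
    unfolding block_mult_def
    by (rule infsum_cong_neutral) (auto simp: block_tridiagonal_def)
  then show ?thesis
    \<comment> \<open>For \<open>j = 0\<close> truncated subtraction gives \<open>j - 1 = j\<close>;
      the index set then has two elements, which accounts for the absent \<open>C\<close>
      term.\<close>
    by (cases j) (auto simp: block_tridiagonal_def algebra_simps)
qed

theorem mainTheorem7:
  fixes \<Phi> :: "nat \<Rightarrow> nat \<Rightarrow> complex^'n^'n \<Rightarrow> complex^'n^'n"
    and A B C :: "nat \<Rightarrow> complex^('n \<times> 'n)^('n \<times> 'n)"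
    and Q :: "nat \<Rightarrow> complex \<Rightarrow> complex^('n \<times> 'n)^('n \<times> 'n)"
    and \<Delta> :: "complex set"
    and W :: "(complex set \<Rightarrow> complex)^('n \<times> 'n)^('n \<times> 'n)"
  assumes "quantum_markov_chain \<Phi>"
    and "\<forall>i j. matrix_rep (\<Phi> i j) = block_tridiagonal A B C i j"
    and "\<forall>n. invertible (A n)"
    and "associated_polynomials A B C Q"
    and "matrix_of_measures \<Delta> W"
    and "finite_moments \<Delta> W"
    and "invertible (matrix_integral \<Delta> W (\<lambda>x. mat 1))"
    and "semi_orthogonal \<Delta> W Q"
  shows "\<forall>i n. block_power (\<lambda>k l. matrix_rep (\<Phi> k l)) n 0 i =
    matrix_inv (matrix_integral \<Delta> W (\<lambda>x. mat 1)) **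
    matrix_integral \<Delta> W (\<lambda>x. map_matrix ((*) (x ^ n)) (Q i x))"
proof -
  let ?P = "block_power (\<lambda>k l. matrix_rep (\<Phi> k l))"
  let ?W0 = "matrix_integral \<Delta> W (\<lambda>x. mat 1)"
  let ?X = "\<lambda>n i x. map_matrix ((*) (x ^ n)) (Q i x)"
  let ?J = "\<lambda>n i. matrix_integral \<Delta> W (?X n i)"
  have rep: "(\<lambda>k l. matrix_rep (\<Phi> k l)) = block_tridiagonal A B C"
    using assms(2) by blast
  \<comment> \<open>The Bochner integral of a nonintegrable function is 0 by default, so integrating
    the recurrence term by term requires integrability of each term.\<close>
  have int: "matrix_integrable \<Delta> W (?X n i)" for n i
    using matrix_integrable_associated_polynomials assms(3,4,6) by blast
  have J0: "?J 0 i = (if i = 0 then ?W0 else 0)" for i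
  proof (cases i)
    case 0
    have "?X 0 0 = (\<lambda>x. mat 1)"
      using assms(4) by (simp add: associated_polynomials_def fun_eq_iff vec_eq_iff)
    with 0 show ?thesis by simp
  next
    case (Suc m)
    then show ?thesis
      using assms(8) unfolding semi_orthogonal_def by (metis nat.simps(3) zero_less_Suc)
  qed
  have J_Suc: "?J (Suc n) i = ?J n (Suc i) ** A i + ?J n i ** B i
      + (if i = 0 then 0 else ?J n (i - 1) ** C i)" for n i
    \<comment> \<open>Only an exponent of the form \<open>Suc n\<close> matches, so the rewriting
      affects the left-hand side alone.\<close>
    unfolding associated_polynomials_shift[OF assms(4)]
    by (cases i) (simp_all add: matrix_integral_add matrix_integral_mult_left
        matrix_integrable_add matrix_integrable_mult_left int)
  have "?P n 0 i = matrix_inv ?W0 ** ?J n i" for n i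
  \<comment> \<open>The step at column \<open>i\<close> uses the hypothesis at its neighbouring
    columns as well.\<close>
  proof (induction n arbitrary: i)
    case 0
    show ?case
      unfolding J0 using assms(7) by (simp add: invertible_matrix_inv(2))
  next
    case (Suc n)
    \<comment> \<open>Powers grow by a factor on the right, so row 0 of the new power involves only
      row 0 of the old one, and the fixed left factor \<open>matrix_inv ?W0\<close> passes through
      the recurrence.\<close>
    have "?P (Suc n) 0 i =
        ?P n 0 (Suc i) ** A i + ?P n 0 i ** B i + (if i = 0 then 0 else ?P n 0 (i - 1) ** C i)"
      unfolding block_power.simps rep block_mult_block_tridiagonal ..
    also have "\<dots> = matrix_inv ?W0 ** ?J (Suc n) i"
      unfolding Suc.IH J_Suc by (simp add: matrix_add_ldistrib matrix_mul_assoc)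
    finally show ?case .
  qed
  then show ?thesis by blast
qed

end
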